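(* For all integers $r\geq 2$ (and $n\geq r$), we have $g(n,r)+1\leq g_c(n,r)\leq g(n,r)+2\sqrt{n}+1$.
   Context: All graphs are finite and simple. An edge-colored graph is a graph with a color assigned to each edge (not necessarily proper). The color degree $d^c_G(v)$ of a vertex $v$ is the number of distinct colors on edges incident to $v$; $\delta^c(G)=\min_v d^c_G(v)$. A subgraph is properly colored if any two adjacent edges of it receive different colors. For positive integers $n\geq r$, $g(n,r)$ is the least integer such that every bipartite digraph $D$ with $n$ vertices in each part and minimum out-degree $\delta^+(D)\geq g(n,r)$ contains a directed cycle of length at most $2r$. Similarly, $g_c(n,r)$ is the least integer such that every edge-colored bipartite graph $G$ with $n$ vertices in each part and $\delta^c(G)\geq g_c(n,r)$ contains a properly colored cycle of length at most $2r$. *)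

theory Defs
  imports Complex_Main "Graph_Theory.Pair_Digraph"
begin

text \<open>
  Graphs and digraphs are finite, so nothing is lost by taking vertices and colors
  in \<^typ>\<open>nat\<close>.
\<close>

subsection \<open>Bipartite digraphs\<close>

text \<open>
  Pairs of opposite arcs are allowed and form a directed cycle of length 2. Forbidding them
  would give the same value of \<open>g_digraph\<close> below, since a digraph with such a pair has a
  directed cycle of length at most \<open>2 * r\<close> anyway.
\<close>

definition bipartite_digraph :: "nat set \<Rightarrow> nat set \<Rightarrow> nat pair_pre_digraph \<Rightarrow> bool" where
  "bipartite_digraph A B D \<longleftrightarrow>
     pair_digraph D \<and> pverts D = A \<union> B \<and> A \<inter> B = {} \<and> parcs D \<subseteq> A \<times> B \<union> B \<times> A"

definition min_out_degree :: "nat pair_pre_digraph \<Rightarrow> nat" where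
  "min_out_degree D = Min (out_degree (with_proj D) ` pverts D)"

text \<open>
  The least integer with the stated property is positive, because the arcless digraph has
  minimum out-degree 0 and no cycle; hence the least natural number is meant. The same applies
  to \<open>g_colored\<close>.
\<close>

definition g_digraph :: "nat \<Rightarrow> nat \<Rightarrow> nat" where
  "g_digraph n r = (LEAST k. \<forall>A B D.
     bipartite_digraph A B D \<and> card A = n \<and> card B = n \<and> k \<le> min_out_degree D \<longrightarrow>
     (\<exists>p. pre_digraph.cycle (with_proj D) p \<and> length p \<le> 2 * r))"


subsection \<open>Edge-colored bipartite graphs\<close>

text \<open>
  A simple graph is given by its vertex set and a set of edges, each edge being the set of its
  two endpoints. Only the values of a coloring on the edges of the graph matter.
\<close>

definition bipartite_graph :: "nat set \<Rightarrow> nat set \<Rightarrow> nat set set \<Rightarrow> bool" where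
  "bipartite_graph A B E \<longleftrightarrow>
     finite A \<and> finite B \<and> A \<inter> B = {} \<and> E \<subseteq> {{a, b} | a b. a \<in> A \<and> b \<in> B}"

definition color_degree :: "nat set set \<Rightarrow> (nat set \<Rightarrow> nat) \<Rightarrow> nat \<Rightarrow> nat" where
  "color_degree E c v = card (c ` {e \<in> E. v \<in> e})"

definition min_color_degree :: "nat set \<Rightarrow> nat set set \<Rightarrow> (nat set \<Rightarrow> nat) \<Rightarrow> nat" where
  "min_color_degree V E c = Min (color_degree E c ` V)"

definition properly_colored :: "(nat set \<Rightarrow> nat) \<Rightarrow> nat set set \<Rightarrow> bool" where
  "properly_colored c F \<longleftrightarrow> (\<forall>e\<in>F. \<forall>f\<in>F. e \<noteq> f \<and> e \<inter> f \<noteq> {} \<longrightarrow> c e \<noteq> c f)"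

text \<open>A cycle is listed by its vertices, without repeating the first one at the end.\<close>

definition cycle_edges :: "nat list \<Rightarrow> nat set set" where
  "cycle_edges vs = {{vs ! i, vs ! (Suc i mod length vs)} | i. i < length vs}"

definition is_cycle :: "nat set set \<Rightarrow> nat list \<Rightarrow> bool" where
  "is_cycle E vs \<longleftrightarrow> 3 \<le> length vs \<and> distinct vs \<and> cycle_edges vs \<subseteq> E"

definition g_colored :: "nat \<Rightarrow> nat \<Rightarrow> nat" where
  "g_colored n r = (LEAST k. \<forall>A B E c.
     bipartite_graph A B E \<and> card A = n \<and> card B = n \<and> k \<le> min_color_degree (A \<union> B) E c \<longrightarrow>
     (\<exists>vs. is_cycle E vs \<and> properly_colored c (cycle_edges vs) \<and> length vs \<le> 2 * r))"

end

theory Submission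
  imports Defs
begin

text \<open>
  Lower bound: in a digraph \<open>D\<close> without short cycles, color every arc by its head. Two consecutive
  edges of a properly colored cycle cannot both point to their common vertex, so such a cycle is a
  directed cycle of \<open>D\<close>. A vertex sees its out-neighbours as colors and, if it has an in-arc, its
  own color as well. To make all in-degrees positive, restrict \<open>D\<close> to a minimal nonempty set that is
  closed under out-neighbours and then duplicate vertices of that set until both parts have size
  \<open>n\<close> again.

  Upper bound: in an edge-minimal counterexample every color class is a union of disjoint stars;
  orient each edge from the leaf to the centre. Directed cycles are then properly colored, and the
  out-degree of \<open>u\<close> falls short of its color degree by the number of colors whose star is centred
  at \<open>u\<close>. Call \<open>u\<close> bad if there are more than \<open>t\<close> of these. As there is no properly
  colored 4-cycle, at most \<open>(n - 1) / t\<close> bad vertices can be joined to a given vertex by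
  edges of distinct colors. So one can delete all arcs into bad vertices, direct all edges between
  bad and good vertices towards the good ones, and lose at most \<open>t + (n - 1) / t\<close> in out-degree;
  \<open>t = \<lfloor>sqrt n\<rfloor>\<close> is the optimal choice.
\<close>

section \<open>Directed cycles as closed vertex sequences\<close>

lemma out_degree_with_proj:
  "out_degree (with_proj D) v = card {w. (v, w) \<in> parcs D}"
proof -
  have "out_arcs (with_proj D) v = Pair v ` {w. (v, w) \<in> parcs D}"
    by (auto simp: out_arcs_def)
  then show ?thesis
    by (simp add: out_degree_def card_image inj_on_def)
qed

text \<open>A library cycle is an arc list whose vertex list is distinct after its first entry. The
  form by positions turns directly into the vertex list of a cycle in a graph.\<close>

lemma cycle_imp_closed_sequence:
  assumes "pre_digraph.cycle (with_proj D) p"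
  obtains f where "0 < length p" "f 0 = f (length p)" "inj_on f {..<length p}"
    "\<And>i. i < length p \<Longrightarrow> (f i, f (Suc i)) \<in> parcs D"
proof -
  obtain u where u: "set p \<subseteq> parcs D" "pcas u p u" "distinct (tl (pawalk_verts u p))" "p \<noteq> []"
    using assms
    by (auto simp: pre_digraph.cycle_def pre_digraph.awalk_def cas_with_proj_eq
        awalk_verts_with_proj_eq)
  define f where "f i = pawalk_verts u p ! i" for i
  have gen: "length (pawalk_verts x q) = Suc (length q) \<and> pawalk_verts x q ! 0 = x
      \<and> pawalk_verts x q ! length q = y
      \<and> (\<forall>i<length q. (pawalk_verts x q ! i, pawalk_verts x q ! Suc i) = q ! i)"
    if "pcas x q y" for x y q
    using that
  proof (induction q arbitrary: x)
    case (Cons e q)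
    then show ?case by (auto simp: nth_Cons' less_Suc_eq_0_disj)
  qed auto
  note g = gen[OF u(2)]
  have ends: "f 0 = f (length p)" using g by (simp add: f_def)
  have inj: "inj_on (\<lambda>i. f (Suc i)) {..<length p}"
    using u(3) g by (auto simp: inj_on_def f_def distinct_conv_nth nth_tl)
  have "inj_on f {..<length p}"
  proof (rule inj_onI)
    fix i j assume "i \<in> {..<length p}" "j \<in> {..<length p}" and eq: "f i = f j"
    then have *: "i < length p" "j < length p" by auto
    \<comment> \<open>\<open>s\<close> is the cyclic predecessor on positions. Injectivity is known
      for heads of arcs, and the vertex at position \<open>i\<close> is the head of the arc at
      \<open>s i\<close>.\<close>
    define s where "s i = (if i = 0 then length p - 1 else i - 1)" for i
    have f: "f i = f (Suc (s i))" for i using ends u(4) by (simp add: s_def)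
    have "f (Suc (s i)) = f (Suc (s j))" using eq f[of i] f[of j] by metis
    then have "s i = s j"
      using inj_onD[OF inj, of "s i" "s j"] * by (auto simp: s_def)
    then show "i = j" using * by (auto simp: s_def split: if_splits)
  qed
  moreover have "(f i, f (Suc i)) \<in> parcs D" if "i < length p" for i
    using g u(1) that nth_mem[of i p] by (auto simp: f_def)
  ultimately show thesis using that ends u(4) by blast
qed

text \<open>Vertices may repeat: the stretch between two occurrences is a shorter closed sequence,
  to which strong induction on \<open>L\<close> applies.\<close>

lemma closed_sequence_imp_cycle:
  assumes "pair_wf_digraph D" "0 < L" "f 0 = f L"
    "\<And>i. i < L \<Longrightarrow> (f i, f (Suc i)) \<in> parcs D"
  shows "\<exists>p. pre_digraph.cycle (with_proj D) p \<and> length p \<le> L"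
  using assms(2-)
proof (induction L arbitrary: f rule: less_induct)
  case (less L)
  show ?case
  proof (cases "inj_on f {0<..L}")
    case True
    define p where "p m = map (\<lambda>i. (f i, f (Suc i))) [m..<L]" for m
    \<comment> \<open>Suffixes of the walk are handled downwards from \<open>L\<close>, because
      vertex list and walk predicate both recurse on the first arc.\<close>
    have walk: "m \<le> L \<Longrightarrow> pawalk_verts (f m) (p m) = map f [m..<Suc L] \<and> pcas (f m) (p m) (f L)"
      for m
    proof (induction rule: inc_induct)
      case (step m)
      then show ?case
        by (simp add: p_def upt_conv_Cons[of m] del: upt_Suc)
    qed (simp add: p_def)
    have "tl (pawalk_verts (f 0) (p 0)) = map f [Suc 0..<Suc L]"
      using walk[of 0] by (simp add: upt_conv_Cons del: upt_Suc)
    moreover have "distinct (map f [Suc 0..<Suc L])"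
      using True by (simp add: distinct_map atLeastLessThanSuc_atLeastAtMost
          atLeastSucAtMost_greaterThanAtMost del: upt_Suc)
    moreover have "set (p 0) \<subseteq> parcs D" "p 0 \<noteq> []"
      using less.prems(1,3) by (auto simp: p_def)
    moreover have "f 0 \<in> pverts D"
      using pair_wf_digraph.in_arcsD1[OF assms(1) less.prems(3)] less.prems(1) by simp
    ultimately have "pre_digraph.cycle (with_proj D) (p 0)"
      unfolding pre_digraph.cycle_def pre_digraph.awalk_def cas_with_proj_eq
        awalk_verts_with_proj_eq
      using walk[of 0] less.prems(2) by (intro exI[of _ "f 0"]) auto
    then show ?thesis by (intro exI[of _ "p 0"]) (auto simp: p_def)
  next
    case False
    then obtain a b where ab: "0 < a" "a < b" "b \<le> L" "f a = f b"
      unfolding inj_on_def by (metis greaterThanAtMost_iff linorder_neqE_nat)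
    have "\<exists>p. pre_digraph.cycle (with_proj D) p \<and> length p \<le> b - a"
      using less.prems(3) ab by (intro less.IH[of "b - a" "\<lambda>i. f (a + i)"]) auto
    then show ?thesis using ab by (meson diff_le_self le_trans)
  qed
qed

section \<open>Properly colored cycles via consecutive edges\<close>

lemma cycle_edges_image:
  "cycle_edges vs = (\<lambda>i. {vs ! i, vs ! (Suc i mod length vs)}) ` {..<length vs}"
  by (auto simp: cycle_edges_def)

text \<open>As the vertices are distinct, two different edges of the cycle meet only at cyclically
  consecutive positions.\<close>

lemma properly_colored_cycle_edgesI:
  assumes "distinct vs"
    and "\<And>i. i < length vs \<Longrightarrow> c {vs ! i, vs ! (Suc i mod length vs)} \<noteq>
      c {vs ! (Suc i mod length vs), vs ! (Suc (Suc i mod length vs) mod length vs)}"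
  shows "properly_colored c (cycle_edges vs)"
  unfolding properly_colored_def
proof (intro ballI impI)
  let ?L = "length vs" and ?e = "\<lambda>i. {vs ! i, vs ! (Suc i mod length vs)}"
  fix e f assume "e \<in> cycle_edges vs" "f \<in> cycle_edges vs" and ef: "e \<noteq> f \<and> e \<inter> f \<noteq> {}"
  then obtain i j where ij: "i < ?L" "e = ?e i" "j < ?L" "f = ?e j"
    unfolding cycle_edges_def by blast
  have lt: "Suc i mod ?L < ?L" "Suc j mod ?L < ?L"
    using ij(1) by (simp_all add: mod_less_divisor[OF le_less_trans[OF le0]])
  have eq: "vs ! a = vs ! b \<longleftrightarrow> a = b" if "a < ?L" "b < ?L" for a b
    using assms(1) that by (simp add: nth_eq_iff_index_eq)
  have "vs ! i = vs ! j \<or> vs ! i = vs ! (Suc j mod ?L) \<or> vs ! (Suc i mod ?L) = vs ! j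
      \<or> vs ! (Suc i mod ?L) = vs ! (Suc j mod ?L)"
    using ef unfolding ij by blast
  then have "i = j \<or> i = Suc j mod ?L \<or> Suc i mod ?L = j \<or> Suc i mod ?L = Suc j mod ?L"
    by (simp only: eq ij(1,3) lt)
  moreover have "i = j" if "Suc i mod ?L = Suc j mod ?L"
    using that ij(1,3) by (simp add: mod_Suc split: if_splits)
  moreover have "i \<noteq> j" using ij(2,4) ef by metis
  ultimately consider "j = Suc i mod ?L" | "i = Suc j mod ?L" by blast
  then show "c e \<noteq> c f"
  proof cases
    case 1
    show ?thesis unfolding ij 1 by (rule assms(2)[OF ij(1)])
  next
    case 2
    show ?thesis unfolding ij 2 by (rule assms(2)[OF ij(3), THEN not_sym])
  qed
qed

text \<open>Length at least 3 makes consecutive edges different sets, so that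
  \<open>properly_colored\<close> applies to them. Reducing every index lets \<open>i\<close> run
  past the end of the list.\<close>

lemma properly_colored_cycle_edgesD:
  assumes "properly_colored c (cycle_edges vs)" "distinct vs" "3 \<le> length vs"
  shows "c {vs ! (i mod length vs), vs ! (Suc i mod length vs)} \<noteq>
      c {vs ! (Suc i mod length vs), vs ! (Suc (Suc i) mod length vs)}"
proof -
  let ?L = "length vs"
  let ?e = "\<lambda>i. {vs ! (i mod ?L), vs ! (Suc i mod ?L)}"
  have L: "i mod ?L < ?L" for i using assms(3) by (intro mod_less_divisor) linarith
  have mem: "?e i \<in> cycle_edges vs" for i
    unfolding cycle_edges_def
    by (rule CollectI, rule exI[of _ "i mod ?L"]) (simp add: mod_Suc_eq L)
  have "i mod ?L \<noteq> Suc i mod ?L" "i mod ?L \<noteq> Suc (Suc i) mod ?L"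
    using assms(3) by (auto simp: mod_Suc)
  then have "vs ! (i mod ?L) \<notin> ?e (Suc i)"
    using nth_eq_iff_index_eq[OF assms(2) L L] by simp
  then have "?e i \<noteq> ?e (Suc i)" by blast
  moreover have "?e i \<inter> ?e (Suc i) \<noteq> {}" by blast
  ultimately show ?thesis
    by (intro assms(1)[unfolded properly_colored_def, rule_format, OF mem mem] conjI)
qed


section \<open>Edges and color degrees in bipartite graphs\<close>

lemma bipartite_graph_edgeD:
  assumes "bipartite_graph A B E" "{u, v} \<in> E"
  shows "u \<in> A \<and> v \<in> B \<or> u \<in> B \<and> v \<in> A" "u \<noteq> v"
proof -
  from assms obtain a b where "{u, v} = {a, b}" "a \<in> A" "b \<in> B" "A \<inter> B = {}"
    unfolding bipartite_graph_def by blast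
  then show "u \<in> A \<and> v \<in> B \<or> u \<in> B \<and> v \<in> A" "u \<noteq> v"
    by (auto simp: doubleton_eq_iff)
qed

lemma bipartite_graph_edges_at:
  assumes "bipartite_graph A B E"
  shows "{e \<in> E. v \<in> e} = (\<lambda>w. {v, w}) ` {w. {v, w} \<in> E}"
proof (intro equalityI subsetI)
  fix e assume e: "e \<in> {e \<in> E. v \<in> e}"
  then obtain a b where "e = {a, b}" using assms unfolding bipartite_graph_def by blast
  then have "e = {v, a} \<or> e = {v, b}" using e by auto
  then show "e \<in> (\<lambda>w. {v, w}) ` {w. {v, w} \<in> E}" using e by auto
qed auto

lemma bipartite_graph_finite:
  assumes "bipartite_graph A B E"
  shows "finite E" "finite {w. {v, w} \<in> E}"
proof -
  have fin: "finite (A \<union> B)" using assms by (simp add: bipartite_graph_def)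
  have "E \<subseteq> Pow (A \<union> B)" using assms unfolding bipartite_graph_def by blast
  then show "finite E" using fin by (meson finite_Pow_iff finite_subset)
  have "{w. {v, w} \<in> E} \<subseteq> A \<union> B" using bipartite_graph_edgeD(1)[OF assms] by blast
  then show "finite {w. {v, w} \<in> E}" using fin by (rule finite_subset)
qed

lemma color_degree_eq:
  assumes "bipartite_graph A B E"
  shows "color_degree E c v = card ((\<lambda>w. c {v, w}) ` {w. {v, w} \<in> E})"
  by (simp add: color_degree_def bipartite_graph_edges_at[OF assms] image_image)

section \<open>Upper bound: orienting monochromatic stars\<close>

text \<open>\<open>P u v\<close> directs the edge \<open>{u, v}\<close> from the leaf \<open>u\<close> to the centre \<open>v\<close> of its monochromatic
  star; a star with a single edge has its centre at either end.\<close>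

locale leaf_orientation =
  fixes A B :: "nat set" and E :: "nat set set" and c :: "nat set \<Rightarrow> nat"
    and P :: "nat \<Rightarrow> nat \<Rightarrow> bool"
  assumes bipartite: "bipartite_graph A B E"
    and oriented: "{u, v} \<in> E \<Longrightarrow> P u v \<or> P v u"
    and asym: "P u v \<Longrightarrow> \<not> P v u"
    and edge: "P u v \<Longrightarrow> {u, v} \<in> E"
    and leaf: "P u v \<Longrightarrow> {u, w} \<in> E \<Longrightarrow> c {u, w} = c {u, v} \<Longrightarrow> w = v"
begin

definition centre_colors :: "nat \<Rightarrow> nat set" where
  "centre_colors u = (\<lambda>w. c {u, w}) ` {w. P w u}"

lemma finite_nbrs: "finite {w. {v, w} \<in> E}" "finite {w. P v w}" "finite {w. P w v}"
proof -
  show *: "finite {w. {v, w} \<in> E}" by (rule bipartite_graph_finite(2)[OF bipartite])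
  show "finite {w. P v w}" by (rule finite_subset[OF _ *]) (auto dest: edge)
  show "finite {w. P w v}"
    by (rule finite_subset[OF _ *]) (auto dest: edge simp: insert_commute)
qed

text \<open>Each color at \<open>u\<close> occurs on an edge leaving \<open>u\<close> or on one
  entering it; the latter colors form \<open>centre_colors u\<close>.\<close>

lemma color_degree_le: "color_degree E c u \<le> card {w. P u w} + card (centre_colors u)"
proof -
  have "(\<lambda>w. c {u, w}) ` {w. {u, w} \<in> E} \<subseteq> (\<lambda>w. c {u, w}) ` {w. P u w} \<union> centre_colors u"
    using oriented by (auto simp: centre_colors_def)
  then have "color_degree E c u \<le> card ((\<lambda>w. c {u, w}) ` {w. P u w} \<union> centre_colors u)"
    unfolding color_degree_eq[OF bipartite]
    by (intro card_mono) (auto simp: centre_colors_def finite_nbrs)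
  also have "\<dots> \<le> card ((\<lambda>w. c {u, w}) ` {w. P u w}) + card (centre_colors u)"
    by (rule card_Un_le)
  also have "\<dots> \<le> card {w. P u w} + card (centre_colors u)"
    by (simp add: card_image_le finite_nbrs)
  finally show ?thesis .
qed

text \<open>Two stars with distinct centres in \<open>U\<close> that share a leaf form a properly colored 4-cycle
  with \<open>v\<close>, so the leaf sets are disjoint.\<close>

lemma card_many_centre_colors:
  assumes no4: "\<And>vs. is_cycle E vs \<Longrightarrow> properly_colored c (cycle_edges vs) \<Longrightarrow> length vs \<noteq> 4"
    and n: "card A = n" "card B = n"
    and v: "v \<in> A \<union> B"
    and U: "U \<subseteq> {x. {v, x} \<in> E}" "inj_on (\<lambda>x. c {v, x}) U"
    and many: "\<And>x. x \<in> U \<Longrightarrow> t < card (centre_colors x)"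
  shows "card U * t \<le> n - 1"
proof -
  \<comment> \<open>Leaving out the color of the edge to \<open>v\<close> keeps the 4-cycle properly
    colored at \<open>x\<close>. It costs at most one color, which the strict inequality in
    \<open>many\<close> pays for.\<close>
  define W where "W x = {w. P w x \<and> c {x, w} \<noteq> c {v, x}}" for x
  have finU: "finite U" using U(1) finite_nbrs(1) finite_subset by blast
  have finW: "finite (W x)" for x
    by (rule finite_subset[OF _ finite_nbrs(3)[of x]]) (auto simp: W_def)
  have disj: "W x \<inter> W y = {}" if xy: "x \<in> U" "y \<in> U" "x \<noteq> y" for x y
  proof (rule ccontr)
    assume "W x \<inter> W y \<noteq> {}"
    then obtain w where w: "P w x" "P w y" "c {x, w} \<noteq> c {v, x}" "c {y, w} \<noteq> c {v, y}"
      by (auto simp: W_def)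
    have E: "{v, x} \<in> E" "{x, w} \<in> E" "{w, y} \<in> E" "{y, v} \<in> E"
      using U(1) xy edge[OF w(1)] edge[OF w(2)] by (auto simp: insert_commute)
    have ne: "v \<noteq> x" "x \<noteq> w" "w \<noteq> y" "y \<noteq> v"
      using E bipartite_graph_edgeD(2)[OF bipartite] by blast+
    have vw: "v \<noteq> w" using w by (auto simp: insert_commute)
    have cxy: "c {v, x} \<noteq> c {v, y}" using U(2) xy by (auto dest: inj_onD)
    \<comment> \<open>\<open>w\<close> is a leaf of the star centred at \<open>y\<close>, so its
      edge to \<open>x\<close> cannot repeat the color of its edge to \<open>y\<close>.\<close>
    have "c {w, x} \<noteq> c {w, y}"
      using leaf[OF w(2), of x] E(2) xy(3) by (auto simp: insert_commute)
    then have cw: "c {v, x} \<noteq> c {x, w}" "c {x, w} \<noteq> c {w, y}" "c {w, y} \<noteq> c {y, v}"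
      "c {y, v} \<noteq> c {v, x}"
      using w(3,4) cxy by (metis insert_commute)+
    let ?vs = "[v, x, w, y]"
    have "cycle_edges ?vs \<subseteq> E"
      unfolding cycle_edges_image using E by (simp add: lessThan_Suc)
    then have "is_cycle E ?vs" using ne vw xy by (auto simp: is_cycle_def)
    moreover have "properly_colored c (cycle_edges ?vs)"
    proof (rule properly_colored_cycle_edgesI)
      fix i assume "i < length ?vs"
      then consider "i = 0" | "i = 1" | "i = 2" | "i = 3" by fastforce
      then show "c {?vs ! i, ?vs ! (Suc i mod length ?vs)} \<noteq> c {?vs ! (Suc i mod length ?vs),
          ?vs ! (Suc (Suc i mod length ?vs) mod length ?vs)}"
        by cases (use cw in simp_all)
    qed (use ne vw xy in auto)
    ultimately show False using no4[of ?vs] by simp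
  qed
  have ge: "t \<le> card (W x)" if "x \<in> U" for x
  proof -
    have "centre_colors x - {c {v, x}} \<subseteq> (\<lambda>w. c {x, w}) ` W x"
      by (auto simp: centre_colors_def W_def)
    then have "card (centre_colors x - {c {v, x}}) \<le> card ((\<lambda>w. c {x, w}) ` W x)"
      by (intro card_mono) (auto simp: finW)
    also have "\<dots> \<le> card (W x)" by (rule card_image_le[OF finW])
    finally show ?thesis
      using many[OF that] by (auto simp: card_Diff_singleton_if split: if_splits)
  qed
  have "card U * t = (\<Sum>x\<in>U. t)" by simp
  also have "\<dots> \<le> (\<Sum>x\<in>U. card (W x))" by (rule sum_mono[OF ge])
  also have "\<dots> = card (\<Union>x\<in>U. W x)"
    using disj finU finW by (intro card_UN_disjoint[symmetric]) auto
  also have "\<dots> \<le> n - 1"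
  proof -
    \<comment> \<open>\<open>X\<close> is the part of \<open>v\<close>. All leaves lie in it, being
      two edges away from \<open>v\<close>, and none equals \<open>v\<close>; hence
      \<open>n - 1\<close>.\<close>
    obtain X where X: "X = A \<or> X = B" "v \<in> X" using v by blast
    have AB: "finite A" "finite B" "A \<inter> B = {}"
      using bipartite by (auto simp: bipartite_graph_def)
    have "w \<in> X - {v}" if "x \<in> U" "w \<in> W x" for x w
    proof -
      have "{v, x} \<in> E" "{w, x} \<in> E" "w \<noteq> v"
        using that U(1) edge by (auto simp: W_def insert_commute)
      then show ?thesis using X AB(3) bipartite_graph_edgeD(1)[OF bipartite] by blast
    qed
    then have "card (\<Union>x\<in>U. W x) \<le> card (X - {v})"
      using X(1) AB by (intro card_mono) auto
    then show ?thesis using X n AB by auto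
  qed
  finally show ?thesis .
qed

text \<open>A good vertex has at most \<open>t\<close> centre colors, and any vertex sees at most
  \<open>b\<close> colors towards bad ones. So \<open>D\<close> keeps out-degree at least
  \<open>g\<close>, and its short cycle, which avoids bad vertices, follows
  \<open>P\<close>.\<close>

lemma colored_cycle_exists:
  assumes digraph: "\<And>D. bipartite_digraph A B D \<Longrightarrow> g \<le> min_out_degree D \<Longrightarrow>
      \<exists>p. pre_digraph.cycle (with_proj D) p \<and> length p \<le> 2 * r"
    and r: "2 \<le> r"
    and n: "card A = n" "card B = n" "0 < n"
    and deg: "\<And>v. v \<in> A \<union> B \<Longrightarrow> g + t + b \<le> color_degree E c v"
    and tb: "\<And>k. k * t \<le> n - 1 \<Longrightarrow> k \<le> b"
  shows "\<exists>vs. is_cycle E vs \<and> properly_colored c (cycle_edges vs) \<and> length vs \<le> 2 * r"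
proof (rule ccontr)
  assume none: "\<not> ?thesis"
  then have no4: "is_cycle E vs \<Longrightarrow> properly_colored c (cycle_edges vs) \<Longrightarrow> length vs \<noteq> 4" for vs
    using r by fastforce
  define bad where "bad x \<longleftrightarrow> t < card (centre_colors x)" for x
  define D where "D = \<lparr>pverts = A \<union> B,
    parcs = {(u, v). {u, v} \<in> E \<and> \<not> bad v \<and> (bad u \<or> P u v)}\<rparr>"
  have AB: "finite A" "finite B" "A \<inter> B = {}"
    using bipartite by (auto simp: bipartite_graph_def)
  have few: "card U \<le> b"
    if "v \<in> A \<union> B" "U \<subseteq> {x. {v, x} \<in> E}" "inj_on (\<lambda>x. c {v, x}) U" "\<And>x. x \<in> U \<Longrightarrow> bad x" for v U
    using card_many_centre_colors[OF no4 n(1,2) that(1-3), of t] that(4) tb by (auto simp: bad_def)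
  have "pair_digraph D"
  proof
    show "finite (parcs D)"
    proof (rule finite_subset)
      show "parcs D \<subseteq> (A \<union> B) \<times> (A \<union> B)"
        using bipartite_graph_edgeD(1)[OF bipartite] by (force simp: D_def)
    qed (use AB in simp)
  qed (use bipartite_graph_edgeD[OF bipartite] AB in \<open>force simp: D_def\<close>)+
  then have bD: "bipartite_digraph A B D"
    using AB(3) bipartite_graph_edgeD(1)[OF bipartite]
    by (auto simp: bipartite_digraph_def D_def)
  have out: "g \<le> card {w. (u, w) \<in> parcs D}" if u: "u \<in> A \<union> B" for u
  proof (cases "bad u")
    case False
    let ?U = "{w. P u w \<and> bad w}"
    \<comment> \<open>Edges leaving \<open>u\<close> have pairwise distinct colors, so
      \<open>few\<close> bounds the number of deleted arcs itself.\<close>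
    have "inj_on (\<lambda>x. c {u, x}) ?U"
      using leaf edge by (auto simp: inj_on_def)
    then have "card ?U \<le> b" using edge by (intro few[OF u]) auto
    moreover have "{w. P u w} = {w. (u, w) \<in> parcs D} \<union> ?U"
      using False edge by (auto simp: D_def)
    then have "card {w. P u w} \<le> card {w. (u, w) \<in> parcs D} + card ?U"
      by (metis card_Un_le)
    ultimately show ?thesis
      using color_degree_le[of u] deg[OF u] False by (simp add: bad_def)
  next
    case True
    let ?c = "\<lambda>w. c {u, w}"
    let ?good = "{w. {u, w} \<in> E \<and> \<not> bad w}" and ?bad = "{w. {u, w} \<in> E \<and> bad w}"
    \<comment> \<open>\<open>U\<close> holds one bad neighbour for each color. As \<open>u\<close>
      has arcs to all its good neighbours, only these colors are lost.\<close>
    obtain U where U: "U \<subseteq> ?bad" "inj_on ?c U" "?c ` U = ?c ` ?bad"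
      using subset_image_inj[of "?c ` ?bad" ?c ?bad] by auto
    have "card (?c ` ?bad) \<le> b"
      using few[OF u, of U] U card_image[OF U(2)] by auto
    moreover have "card (?c ` ?good) \<le> card ?good"
      by (rule card_image_le) (rule finite_subset[OF _ finite_nbrs(1)[of u]], auto)
    moreover have colors: "?c ` {w. {u, w} \<in> E} = ?c ` ?good \<union> ?c ` ?bad" by auto
    have "color_degree E c u \<le> card (?c ` ?good) + card (?c ` ?bad)"
      unfolding color_degree_eq[OF bipartite] colors by (rule card_Un_le)
    moreover have "{w. (u, w) \<in> parcs D} = ?good" using True by (auto simp: D_def)
    ultimately show ?thesis using deg[OF u] by simp
  qed
  have "A \<union> B \<noteq> {}" using n by auto
  then have "g \<le> min_out_degree D"
    unfolding min_out_degree_def out_degree_with_proj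
    using out AB by (subst Min_ge_iff) (auto simp: D_def)
  then obtain p where p: "pre_digraph.cycle (with_proj D) p" "length p \<le> 2 * r"
    using digraph[OF bD] by blast
  then obtain f where f: "0 < length p" "f 0 = f (length p)" "inj_on f {..<length p}"
    "\<And>i. i < length p \<Longrightarrow> (f i, f (Suc i)) \<in> parcs D"
    by (metis cycle_imp_closed_sequence)
  let ?L = "length p"
  \<comment> \<open>Every vertex of the cycle is the head of one of its arcs, and \<open>D\<close>
    has no arc into a bad vertex.\<close>
  have good: "\<not> bad (f i)" if "i \<le> ?L" for i
  proof -
    have "\<exists>j<?L. f i = f (Suc j)"
      using that f(1,2)
      by (intro exI[of _ "if i = 0 then ?L - 1 else i - 1"]) auto
    then show ?thesis using f(4) by (auto simp: D_def)
  qed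
  have P: "P (f i) (f (Suc i))" if "i < ?L" for i
    using f(4)[OF that] good[of i] that by (simp add: D_def)
  have wrap: "f (Suc i mod ?L) = f (Suc i)" if "i < ?L" for i
    using that f(2) by (cases "Suc i = ?L") auto
  have L3: "3 \<le> ?L"
  proof (rule ccontr)
    assume "\<not> 3 \<le> ?L"
    then consider "?L = 1" | "?L = 2" using f(1) by linarith
    then show False
    proof cases
      case 1 then show False using P[of 0] f(2) asym by auto
    next
      case 2 then show False using P[of 0] P[of 1] f(2) asym by (auto simp: numeral_2_eq_2)
    qed
  qed
  define vs where "vs = map f [0..<?L]"
  have len: "length vs = ?L" by (simp add: vs_def)
  have nth: "vs ! i = f i" if "i < ?L" for i using that by (simp add: vs_def)
  have nthS: "vs ! (Suc i mod ?L) = f (Suc i)" if "i < ?L" for i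
  proof -
    have "Suc i mod ?L < ?L" using f(1) by (rule mod_less_divisor)
    then show ?thesis by (simp add: nth wrap that)
  qed
  have dist: "distinct vs" using f(3) by (simp add: vs_def distinct_map atLeast0LessThan)
  have "cycle_edges vs \<subseteq> E"
    unfolding cycle_edges_def len using edge[OF P] by (auto simp: nth nthS)
  then have "is_cycle E vs" using dist L3 len by (simp add: is_cycle_def)
  moreover have "properly_colored c (cycle_edges vs)"
  proof (rule properly_colored_cycle_edgesI[OF dist], unfold len)
    fix i assume i: "i < ?L"
    let ?j = "Suc i mod ?L"
    have j: "?j < ?L" using f(1) by (rule mod_less_divisor)
    have P1: "P (f i) (f ?j)" using P[OF i] wrap[OF i] by simp
    have P2: "P (f ?j) (f (Suc ?j))" using P[OF j] .
    \<comment> \<open>The outgoing edge has a color that occurs only once at its tail, hence not on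
      the incoming edge.\<close>
    have "c {f ?j, f i} \<noteq> c {f ?j, f (Suc ?j)}"
    proof
      assume "c {f ?j, f i} = c {f ?j, f (Suc ?j)}"
      then have "f i = f (Suc ?j)"
        using leaf[OF P2, of "f i"] edge[OF P1] by (simp add: insert_commute)
      then show False using asym[OF P1] P2 by simp
    qed
    then show "c {vs ! i, vs ! ?j} \<noteq> c {vs ! ?j, vs ! (Suc ?j mod ?L)}"
      using nth[OF i] nth[OF j] nthS[OF j] by (simp add: insert_commute)
  qed
  ultimately show False using none p(2) len by auto
qed

end

section \<open>Edge-minimal subgraphs with large color degrees\<close>

text \<open>If the color of an edge reappeared at both of its ends, deleting the edge would preserve
  all color degrees, against minimality. So it is unique at some end, which serves as the
  leaf.\<close>

lemma leaf_orientation_exists: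
  assumes bip: "bipartite_graph A B E"
    and deg: "\<And>v. v \<in> A \<union> B \<Longrightarrow> m \<le> color_degree E c v"
  obtains E' P where "E' \<subseteq> E" "leaf_orientation A B E' c P"
    "\<And>v. v \<in> A \<union> B \<Longrightarrow> m \<le> color_degree E' c v"
proof -
  define Q where "Q F \<longleftrightarrow> F \<subseteq> E \<and> (\<forall>v\<in>A \<union> B. m \<le> color_degree F c v)" for F
  have "Q E" using deg by (simp add: Q_def)
  then obtain E' where E': "Q E'" "\<And>F. Q F \<Longrightarrow> card E' \<le> card F"
    using ex_has_least_nat[of Q E card] by blast
  have sub: "E' \<subseteq> E" using E'(1) by (simp add: Q_def)
  have bip': "bipartite_graph A B E'" using bip sub unfolding bipartite_graph_def by blast
  have fin: "finite E'" by (rule bipartite_graph_finite(1)[OF bip'])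
  define uniq where "uniq u v \<longleftrightarrow> (\<forall>w. {u, w} \<in> E' \<longrightarrow> c {u, w} = c {u, v} \<longrightarrow> w = v)" for u v
  have key: "uniq u v \<or> uniq v u" if uv: "{u, v} \<in> E'" for u v
  proof (rule ccontr)
    assume "\<not> (uniq u v \<or> uniq v u)"
    then obtain x y where x: "{u, x} \<in> E'" "c {u, x} = c {u, v}" "x \<noteq> v"
      and y: "{v, y} \<in> E'" "c {v, y} = c {v, u}" "y \<noteq> u"
      unfolding uniq_def by blast
    let ?F = "E' - {{u, v}}"
    have "color_degree E' c z \<le> color_degree ?F c z" for z
    proof -
      have "c e \<in> c ` {e \<in> ?F. z \<in> e}" if e: "e \<in> E'" "z \<in> e" for e
      proof (cases "e = {u, v}")
        case True
        then consider "z = u" | "z = v" using e by blast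
        then show ?thesis
        proof cases
          case 1
          show ?thesis
            by (rule image_eqI[of _ _ "{u, x}"]) (use True 1 x in \<open>auto simp: doubleton_eq_iff\<close>)
        next
          case 2
          show ?thesis
            by (rule image_eqI[of _ _ "{v, y}"])
              (use True 2 y in \<open>auto simp: doubleton_eq_iff insert_commute\<close>)
        qed
      qed (use e in blast)
      then have "c ` {e \<in> E'. z \<in> e} \<subseteq> c ` {e \<in> ?F. z \<in> e}" by blast
      then show ?thesis unfolding color_degree_def by (intro card_mono) (use fin in simp_all)
    qed
    then have "Q ?F" using E'(1) unfolding Q_def by (meson Diff_subset order_trans)
    then have "card E' \<le> card ?F" by (rule E'(2))
    moreover have "card ?F < card E'" by (rule card_Diff1_less[OF fin uv])
    ultimately show False by simp
  qed
  \<comment> \<open>When the color is unique at both ends, the tie is broken by directing the edge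
    from \<open>A\<close> to \<open>B\<close>.\<close>
  define P where "P u v \<longleftrightarrow> {u, v} \<in> E' \<and> uniq u v \<and> (u \<in> A \<or> \<not> uniq v u)" for u v
  have "leaf_orientation A B E' c P"
  proof
    show "P u v \<or> P v u" if "{u, v} \<in> E'" for u v
      using that key[OF that] bipartite_graph_edgeD(1)[OF bip' that]
      by (auto simp: P_def insert_commute)
    show "\<not> P v u" if "P u v" for u v
      using that bipartite_graph_edgeD(1)[OF bip', of u v] bip'
      by (auto simp: P_def bipartite_graph_def)
  qed (use bip' in \<open>auto simp: P_def uniq_def\<close>)
  then show thesis using that sub E'(1) by (auto simp: Q_def)
qed

section \<open>Lower bound: coloring arcs by their heads\<close>

text \<open>The extra color at \<open>v\<close> is \<open>v\<close> itself, carried by an arc into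
  \<open>v\<close>; the other \<open>k\<close> are out-neighbours of the vertex that
  \<open>v\<close> copies.\<close>

lemma colored_counterexample:
  assumes bip: "bipartite_digraph A B D"
    and n: "card A = n" "card B = n" "0 < n"
    and k: "0 < k" "k \<le> min_out_degree D"
    and r: "0 < r"
    and acyc: "\<not> (\<exists>p. pre_digraph.cycle (with_proj D) p \<and> length p \<le> 2 * r)"
  shows "\<exists>E c. bipartite_graph A B E \<and> k + 1 \<le> min_color_degree (A \<union> B) E c \<and>
    \<not> (\<exists>vs. is_cycle E vs \<and> properly_colored c (cycle_edges vs) \<and> length vs \<le> 2 * r)"
proof -
  interpret pair_digraph D using bip by (simp add: bipartite_digraph_def)
  have V: "pverts D = A \<union> B" "A \<inter> B = {}" and fin: "finite A" "finite B"
    using bip pair_finite_verts by (auto simp: bipartite_digraph_def)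
  let ?R = "parcs D"
  have side: "u \<in> A \<and> v \<in> B \<or> u \<in> B \<and> v \<in> A" if "(u, v) \<in> ?R" for u v
    using bip that unfolding bipartite_digraph_def by blast
  have noseq: False if "0 < L" "L \<le> 2 * r" "f 0 = f L" "\<And>i. i < L \<Longrightarrow> (f i, f (Suc i)) \<in> ?R"
    for f and L :: nat
    using closed_sequence_imp_cycle[OF pair_wf_digraph_axioms that(1,3,4)] acyc that(2)
    by (meson order_trans)
  have asym: "(v, u) \<notin> ?R" if "(u, v) \<in> ?R" for u v
  proof
    assume vu: "(v, u) \<in> ?R"
    show False
      by (rule noseq[of 2 "\<lambda>i. if i = 1 then v else u"])
        (use r that vu in \<open>auto simp: less_Suc_eq numeral_2_eq_2\<close>)
  qed
  have outdeg: "k \<le> card {w. (v, w) \<in> ?R}" if "v \<in> A \<union> B" for v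
  proof -
    have "min_out_degree D \<le> out_degree (with_proj D) v"
      unfolding min_out_degree_def using that fin by (intro Min_le) (auto simp: V)
    then show ?thesis using k(2) by (simp add: out_degree_with_proj)
  qed
  have succ: "\<exists>w. (v, w) \<in> ?R" if "v \<in> A \<union> B" for v
  proof (rule ccontr)
    assume "\<nexists>w. (v, w) \<in> ?R"
    then show False using outdeg[OF that] k(1) by simp
  qed
  define Q where "Q S \<longleftrightarrow> S \<subseteq> A \<union> B \<and> S \<noteq> {} \<and> (\<forall>u\<in>S. \<forall>v. (u, v) \<in> ?R \<longrightarrow> v \<in> S)" for S
  have "Q (A \<union> B)" using side n by (fastforce simp: Q_def)
  then obtain S where S: "Q S" "\<And>T. Q T \<Longrightarrow> card S \<le> card T"
    using ex_has_least_nat[of Q "A \<union> B" card] by blast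
  have SV: "S \<subseteq> A \<union> B" "S \<noteq> {}" and closed: "\<And>u v. u \<in> S \<Longrightarrow> (u, v) \<in> ?R \<Longrightarrow> v \<in> S"
    using S(1) by (auto simp: Q_def)
  \<comment> \<open>A vertex of \<open>S\<close> without an in-arc from \<open>S\<close> could be
    removed, leaving a smaller closed set; it is nonempty because the out-neighbour \<open>w\<close>
    remains.\<close>
  have pred: "\<exists>u\<in>S. (u, v) \<in> ?R" if v: "v \<in> S" for v
  proof (rule ccontr)
    assume no: "\<not> ?thesis"
    obtain w where w: "(v, w) \<in> ?R" using succ v SV(1) by blast
    then have "w \<in> S" "w \<noteq> v" using closed v asym by blast+
    then have "Q (S - {v})" using SV(1) closed no by (auto simp: Q_def)
    then have "card S \<le> card (S - {v})" by (rule S(2))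
    moreover have "card (S - {v}) < card S"
      using v SV(1) fin by (intro card_Diff1_less) (auto intro: finite_subset)
    ultimately show False by simp
  qed
  obtain s where s: "s \<in> S" using SV(2) by blast
  obtain s' where s': "s' \<in> S" "(s, s') \<in> ?R" using closed s succ SV(1) by blast
  then obtain a b where ab: "a \<in> S \<inter> A" "b \<in> S \<inter> B" using side[OF s'(2)] s by blast
  \<comment> \<open>Vertices outside \<open>S\<close> become copies of \<open>a\<close> or
    \<open>b\<close>, whichever lies in the same part, so both parts keep \<open>n\<close>
    vertices.\<close>
  define \<phi> where "\<phi> x = (if x \<in> S then x else if x \<in> A then a else b)" for x
  have \<phi>S: "\<phi> x = x" if "x \<in> S" for x using that by (simp add: \<phi>_def)
  have \<phi>_in: "\<phi> x \<in> S" for x using ab by (simp add: \<phi>_def)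
  have \<phi>_side: "\<phi> x \<in> A \<longleftrightarrow> x \<in> A" "\<phi> x \<in> B \<longleftrightarrow> x \<in> B" if "x \<in> A \<union> B" for x
    using ab that V(2) by (auto simp: \<phi>_def)
  define H where "H u v \<longleftrightarrow> u \<in> A \<union> B \<and> v \<in> A \<union> B \<and> (\<phi> u, \<phi> v) \<in> ?R" for u v
  define E where "E = {{u, v} | u v. H u v}"
  \<comment> \<open>The choice is unambiguous, as \<open>H\<close> never contains both directions of
    an edge.\<close>
  define c where "c e = (SOME v. \<exists>u. e = {u, v} \<and> H u v)" for e
  have HD: "u \<in> A \<and> v \<in> B \<or> u \<in> B \<and> v \<in> A" if "H u v" for u v
    using that side[of "\<phi> u" "\<phi> v"] \<phi>_side[of u] \<phi>_side[of v] by (auto simp: H_def)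
  have H_asym: "\<not> H v u" if "H u v" for u v
    using that asym by (auto simp: H_def)
  have c_head: "c {u, v} = v" if "H u v" for u v
    unfolding c_def
  proof (rule some_equality)
    show "\<exists>u'. {u, v} = {u', v} \<and> H u' v" using that by blast
    show "v' = v" if "\<exists>u'. {u, v} = {u', v'} \<and> H u' v'" for v'
      using that H_asym[OF \<open>H u v\<close>] by (auto simp: doubleton_eq_iff)
  qed
  have E_iff: "{u, v} \<in> E \<longleftrightarrow> H u v \<or> H v u" for u v
    unfolding E_def by (auto simp: doubleton_eq_iff)
  have "E \<subseteq> {{a, b} | a b. a \<in> A \<and> b \<in> B}"
    unfolding E_def using HD by (blast intro: insert_commute)
  then have bG: "bipartite_graph A B E"
    using fin V by (simp add: bipartite_graph_def)

  have "k + 1 \<le> color_degree E c v" if v: "v \<in> A \<union> B" for v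
  proof -
    let ?N = "{w. (\<phi> v, w) \<in> ?R}"
    have "?N \<subseteq> A \<union> B" using side by blast
    then have finN: "finite ?N" using fin by (auto intro: finite_subset)
    \<comment> \<open>An arc from \<open>\<phi> v\<close> to \<open>v\<close> would put
      \<open>v\<close> in \<open>S\<close>, making it a loop; thus the color \<open>v\<close> is a
      new one.\<close>
    have "v \<notin> ?N"
    proof
      assume "v \<in> ?N"
      then have "(\<phi> v, v) \<in> ?R" "v \<in> S" using closed \<phi>_in by blast+
      then show False using asym \<phi>S by metis
    qed
    then have "k + 1 \<le> card (insert v ?N)"
      using outdeg[of "\<phi> v"] \<phi>_in SV(1) finN by auto
    also have "\<dots> \<le> color_degree E c v"
      unfolding color_degree_eq[OF bG]
    proof (rule card_mono)
      show "finite ((\<lambda>w. c {v, w}) ` {w. {v, w} \<in> E})"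
        by (intro finite_imageI bipartite_graph_finite(2)[OF bG])
      have "w \<in> (\<lambda>w. c {v, w}) ` {w. {v, w} \<in> E}" if "w \<in> ?N" for w
      proof -
        have "w \<in> S" using that closed \<phi>_in by blast
        then have "H v w" using that v SV(1) by (auto simp: H_def \<phi>S)
        then show ?thesis by (intro image_eqI[of _ _ w]) (auto simp: c_head E_iff)
      qed
      moreover have "v \<in> (\<lambda>w. c {v, w}) ` {w. {v, w} \<in> E}"
      proof -
        obtain u where u: "u \<in> S" "(u, \<phi> v) \<in> ?R" using pred \<phi>_in by blast
        then have "H u v" using v SV(1) by (auto simp: H_def \<phi>S)
        then show ?thesis
          by (intro image_eqI[of _ _ u]) (auto simp: c_head E_iff insert_commute[of v u])
      qed
      ultimately show "insert v ?N \<subseteq> (\<lambda>w. c {v, w}) ` {w. {v, w} \<in> E}" by blast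
    qed
    finally show ?thesis .
  qed
  moreover have "A \<union> B \<noteq> {}" using n by auto
  ultimately have "k + 1 \<le> min_color_degree (A \<union> B) E c"
    unfolding min_color_degree_def using fin by (subst Min_ge_iff) auto
  moreover have False
    if cyc: "is_cycle E vs" "properly_colored c (cycle_edges vs)" "length vs \<le> 2 * r" for vs
  proof -
    let ?L = "length vs"
    define x where "x i = vs ! (i mod ?L)" for i
    have L3: "3 \<le> ?L" and dist: "distinct vs" and sub: "cycle_edges vs \<subseteq> E"
      using cyc(1) by (auto simp: is_cycle_def)
    have L0: "0 < ?L" using L3 by linarith
    have HH: "H (x i) (x (Suc i)) \<or> H (x (Suc i)) (x i)" for i
    proof -
      have "{x i, x (Suc i)} \<in> cycle_edges vs"
        unfolding cycle_edges_def x_def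
        by (rule CollectI, rule exI[of _ "i mod ?L"]) (simp add: mod_Suc_eq mod_less_divisor[OF L0])
      then show ?thesis using sub E_iff by blast
    qed
    \<comment> \<open>Were the next edge directed backwards, both edges would have their common
      vertex as head, and hence the same color.\<close>
    have step: "H (x (Suc i)) (x (Suc (Suc i)))" if "H (x i) (x (Suc i))" for i
    proof (rule ccontr)
      assume "\<not> ?thesis"
      then have "H (x (Suc (Suc i))) (x (Suc i))" using HH by blast
      then have "c {x i, x (Suc i)} = c {x (Suc i), x (Suc (Suc i))}"
        using that c_head by (metis insert_commute)
      then show False
        using properly_colored_cycle_edgesD[OF cyc(2) dist L3, of i] by (simp add: x_def)
    qed
    show False
    \<comment> \<open>Either one forward edge forces all later ones forward, or all edges point
      backwards. Under \<open>\<phi>\<close> vertices may coincide, which \<open>noseq\<close>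
      tolerates.\<close>
    proof (cases "\<exists>j. H (x j) (x (Suc j))")
      case True
      then obtain j where j: "H (x j) (x (Suc j))" ..
      have "H (x (j + i)) (x (Suc (j + i)))" for i
        by (induction i) (use j step in simp_all)
      then show False
        by (intro noseq[of ?L "\<lambda>i. \<phi> (x (j + i))"])
          (use L0 cyc(3) in \<open>simp_all add: H_def x_def\<close>)
    next
      case False
      then have "H (x (Suc i)) (x i)" for i using HH by blast
      then have "(\<phi> (x (?L - i)), \<phi> (x (?L - Suc i))) \<in> ?R" if "i < ?L" for i
        using that by (metis H_def Suc_diff_Suc)
      then show False
        by (intro noseq[of ?L "\<lambda>i. \<phi> (x (?L - i))"]) (use L0 cyc(3) in \<open>simp_all add: x_def\<close>)
    qed
  qed
  ultimately show ?thesis using bG by blast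
qed

section \<open>Choice of the threshold and a degree bound\<close>

lemma floor_sqrt_exists: "\<exists>t::nat. t * t \<le> n \<and> n < (t + 1) * (t + 1)"
proof (induction n)
  case (Suc n)
  then obtain t where t: "t * t \<le> n" "n < (t + 1) * (t + 1)" by blast
  show ?case
  proof (cases "Suc n < (t + 1) * (t + 1)")
    case True
    then show ?thesis using t by (intro exI[of _ t]) simp
  next
    case False
    then show ?thesis using t by (intro exI[of _ "t + 1"]) simp
  qed
qed simp

lemma min_out_degree_le:
  assumes "bipartite_digraph A B D" "card B = n" "A \<noteq> {}"
  shows "min_out_degree D \<le> n"
proof -
  obtain v where v: "v \<in> A" using assms(3) by blast
  have V: "pverts D = A \<union> B" and fin: "finite (pverts D)"
    using assms(1) pair_fin_digraph.pair_finite_verts[of D]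
    by (simp_all add: bipartite_digraph_def pair_digraph_def)
  have "min_out_degree D \<le> out_degree (with_proj D) v"
    unfolding min_out_degree_def using v V fin by (intro Min_le) auto
  also have "\<dots> \<le> card B"
    unfolding out_degree_with_proj
    by (rule card_mono) (use assms(1) v V fin in \<open>auto simp: bipartite_digraph_def\<close>)
  finally show ?thesis using assms(2) by simp
qed

lemma sqrt_split:
  assumes "0 < n"
  obtains t b :: nat where "\<And>k. k * t \<le> n - 1 \<Longrightarrow> k \<le> b" "real (t + b) \<le> 2 * sqrt (real n)"
proof -
  obtain t :: nat where t: "t * t \<le> n" "n < (t + 1) * (t + 1)"
    using floor_sqrt_exists by blast
  have t0: "0 < t" using t assms by (cases t) auto
  define b where "b = (n - 1) div t"
  have bt: "b * t \<le> n - 1" by (simp add: b_def)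
  have "(t + b) * (t + b) \<le> 4 * n"
  proof (cases "b \<le> t")
    case True
    then have "(t + b) * (t + b) \<le> (2 * t) * (2 * t)" by (intro mult_mono) auto
    then show ?thesis using t(1) by simp
  next
    case False
    \<comment> \<open>From \<open>n - 1 < t * (t + 2)\<close> only \<open>b = t + 1\<close> remains,
      and then \<open>(2 * t + 1)^2 = 4 * b * t + 1 < 4 * n\<close>.\<close>
    have "b * t < (t + 2) * t" using bt t(2) assms by (simp add: algebra_simps)
    then have "b < t + 2" by (rule mult_right_less_imp_less) simp
    then have "b = t + 1" using False by simp
    then show ?thesis using bt assms by (simp add: algebra_simps)
  qed
  then have "real ((t + b) * (t + b)) \<le> real (4 * n)" by (rule of_nat_mono)
  then have "real (t + b) \<le> sqrt (4 * real n)"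
    by (intro real_le_rsqrt) (simp add: power2_eq_square)
  then have "real (t + b) \<le> 2 * sqrt (real n)" by (simp add: real_sqrt_mult)
  moreover have "k \<le> b" if "k * t \<le> n - 1" for k
    using that t0 by (simp add: b_def less_eq_div_iff_mult_less_eq)
  ultimately show thesis using that by blast
qed

section \<open>Comparison of the two least integers\<close>

theorem theorem1p2:
  fixes n r :: nat
  assumes "r \<ge> 2" and "n \<ge> r"
  shows "g_digraph n r + 1 \<le> g_colored n r \<and>
         real (g_colored n r) \<le> real (g_digraph n r) + 2 * sqrt (real n) + 1"
proof -
  have n: "0 < n" and r: "0 < r" using assms by auto
  define Q where "Q k \<longleftrightarrow> (\<forall>A B D.
     bipartite_digraph A B D \<and> card A = n \<and> card B = n \<and> k \<le> min_out_degree D \<longrightarrow>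
     (\<exists>p. pre_digraph.cycle (with_proj D) p \<and> length p \<le> 2 * r))" for k
  define K where "K k \<longleftrightarrow> (\<forall>A B E c.
     bipartite_graph A B E \<and> card A = n \<and> card B = n \<and> k \<le> min_color_degree (A \<union> B) E c \<longrightarrow>
     (\<exists>vs. is_cycle E vs \<and> properly_colored c (cycle_edges vs) \<and> length vs \<le> 2 * r))" for k
  define g where "g = g_digraph n r"
  have g_least: "g = (LEAST k. Q k)" unfolding g_def g_digraph_def Q_def ..
  have gc_least: "g_colored n r = (LEAST k. K k)" unfolding g_colored_def K_def ..

  \<comment> \<open>No minimum out-degree exceeds \<open>n\<close>, so this instance is vacuous; it
    ensures that the least \<open>k\<close> exists.\<close>
  have "Q (n + 1)"
    unfolding Q_def
  proof (intro allI impI)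
    fix A B D
    assume D: "bipartite_digraph A B D \<and> card A = n \<and> card B = n \<and> n + 1 \<le> min_out_degree D"
    then have "A \<noteq> {}" using n by auto
    then have "min_out_degree D \<le> n" using D min_out_degree_le by blast
    then show "\<exists>p. pre_digraph.cycle (with_proj D) p \<and> length p \<le> 2 * r" using D by simp
  qed
  then have Qg: "Q g" unfolding g_least by (rule LeastI)

  obtain t b where tb: "\<And>k. k * t \<le> n - 1 \<Longrightarrow> k \<le> b" "real (t + b) \<le> 2 * sqrt (real n)"
    using sqrt_split[OF n] by metis
  have Kg: "K (g + t + b)"
    unfolding K_def
  proof (intro allI impI)
    fix A B E c
    assume G: "bipartite_graph A B E \<and> card A = n \<and> card B = n \<and>
      g + t + b \<le> min_color_degree (A \<union> B) E c"
    then have bip: "bipartite_graph A B E" and fin: "finite (A \<union> B)"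
      by (auto simp: bipartite_graph_def)
    have "g + t + b \<le> color_degree E c v" if "v \<in> A \<union> B" for v
    proof -
      have "min_color_degree (A \<union> B) E c \<le> color_degree E c v"
        unfolding min_color_degree_def using fin that by (intro Min_le) auto
      then show ?thesis using G by linarith
    qed
    then obtain E' P where E': "E' \<subseteq> E" "leaf_orientation A B E' c P"
      "\<And>v. v \<in> A \<union> B \<Longrightarrow> g + t + b \<le> color_degree E' c v"
      using leaf_orientation_exists[OF bip] by metis
    have "\<exists>vs. is_cycle E' vs \<and> properly_colored c (cycle_edges vs) \<and> length vs \<le> 2 * r"
    proof (rule leaf_orientation.colored_cycle_exists[OF E'(2) _ assms(1) _ _ n E'(3) tb(1)])
      show "\<exists>p. pre_digraph.cycle (with_proj D) p \<and> length p \<le> 2 * r"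
        if "bipartite_digraph A B D" "g \<le> min_out_degree D" for D
        using Qg G that unfolding Q_def by blast
    qed (use G in auto)
    then show "\<exists>vs. is_cycle E vs \<and> properly_colored c (cycle_edges vs) \<and> length vs \<le> 2 * r"
      using E'(1) unfolding is_cycle_def by blast
  qed
  have upper: "g_colored n r \<le> g + t + b" unfolding gc_least using Kg by (rule Least_le)

  have Kgc: "K (g_colored n r)" unfolding gc_least using Kg by (rule LeastI)
  have mono: "K j" if "K i" "i \<le> j" for i j
    using that(1) order_trans[OF that(2)] unfolding K_def by blast
  \<comment> \<open>The monochromatic complete bipartite graph has color degree 1 and no properly
    colored cycle. This yields \<open>1 < g\<close> below, so that the positive degree
    \<open>g - 1\<close> can be fed to the construction.\<close>
  have notK1: "\<not> K 1"
  proof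
    assume K1: "K 1"
    define A B :: "nat set" where "A = {..<n}" and "B = {n..<2 * n}"
    define E where "E = {{a, b} | a b. a \<in> A \<and> b \<in> B}"
    define c :: "nat set \<Rightarrow> nat" where "c = (\<lambda>_. 0)"
    have bip: "bipartite_graph A B E"
      by (auto simp: bipartite_graph_def A_def B_def E_def)
    have "1 \<le> color_degree E c v" if v: "v \<in> A \<union> B" for v
    proof -
      have "0 \<in> A" "n \<in> B" using n by (auto simp: A_def B_def)
      then have "{0, v} \<in> E \<or> {v, n} \<in> E" using v unfolding E_def by blast
      then have "c ` {e \<in> E. v \<in> e} = {0}" by (auto simp: c_def)
      then show ?thesis by (simp add: color_degree_def)
    qed
    then have "1 \<le> min_color_degree (A \<union> B) E c"
      unfolding min_color_degree_def using n by (subst Min_ge_iff) (auto simp: A_def B_def)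
    moreover have "card A = n" "card B = n" by (simp_all add: A_def B_def)
    ultimately obtain vs where vs: "is_cycle E vs" "properly_colored c (cycle_edges vs)"
      using K1 bip unfolding K_def by blast
    then show False
      using properly_colored_cycle_edgesD[of c vs 0] by (auto simp: is_cycle_def c_def)
  qed
  have "g + 1 \<le> g_colored n r"
  proof (rule ccontr)
    assume "\<not> ?thesis"
    then have Kg': "K g" using mono[OF Kgc] by simp
    then have "1 < g" using notK1 mono by (meson linorder_not_less)
    then have g1: "g - 1 < g" "0 < g - 1" "g - 1 + 1 = g" by auto
    \<comment> \<open>A digraph witnessing the failure at \<open>g - 1\<close> yields a coloring
      with minimum color degree at least \<open>g\<close>, contradicting \<open>K g\<close>.\<close>
    have "\<not> Q (g - 1)" using not_less_Least g1(1) unfolding g_least by blast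
    then obtain A B D where D: "bipartite_digraph A B D" "card A = n" "card B = n"
      "g - 1 \<le> min_out_degree D"
      "\<not> (\<exists>p. pre_digraph.cycle (with_proj D) p \<and> length p \<le> 2 * r)"
      unfolding Q_def by blast
    show False
      using colored_counterexample[OF D(1-3) n g1(2) D(4) r D(5)] Kg' D(2,3)
      unfolding K_def g1(3) by blast
  qed
  moreover have "real (g_colored n r) \<le> real g + 2 * sqrt (real n) + 1"
    using upper tb(2) by linarith
  ultimately show ?thesis by (simp add: g_def)
qed

end
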